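(* Consider the \textsc{Rank}-$k$ problem on $n$ elements in the noisy comparison model. Let $A$ be an algorithm for the \textsc{Rank}-$k$ problem with success probability at least $2/3$ (on every input). Then the query complexity of $A$ is at least $\Omega(n\log k)$.
   Context: \textsc{Rank}-$k$ problem: the input is a set of $n$ elements with pairwise distinct values; the goal is to output the set of the $k$ elements with the largest values. Noisy comparison model: queries ``is the value of $x$ at least the value of $y$?'' are answered correctly with probability $2/3$ and arbitrarily (adversarially) otherwise.
   Formalization: The bound is proved for 1 ≤ k ≤ (1−ε)n, for each fixed ε > 0, with the constant in Ω depending on ε; without some such restriction it fails (for k = n no queries are needed, and for k = n−1 finding the minimum takes O(n) queries). *)

theory Defs
  imports "HOL-Probability.Probability"
begin

text \<open>The elements are the labels \<open>0, \<dots>, n - 1\<close>; the input is the assignment of values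
  \<open>v\<close>, which is accessible only through comparisons.\<close>

definition is_top :: "nat \<Rightarrow> nat \<Rightarrow> (nat \<Rightarrow> real) \<Rightarrow> nat set \<Rightarrow> bool" where
  "is_top n k v S \<longleftrightarrow>
     S \<subseteq> {..<n} \<and> card S = k \<and> (\<forall>x\<in>S. \<forall>y\<in>{..<n} - S. v y < v x)"

text \<open>\<open>Query x y t\<close> asks whether the value of \<open>x\<close> is at least the value of \<open>y\<close> and continues
  with \<open>t a\<close> on answer \<open>a\<close>.\<close>

datatype dtree = Output "nat set" | Query nat nat "bool \<Rightarrow> dtree"

primrec queries_within :: "nat \<Rightarrow> dtree \<Rightarrow> bool" where
  "queries_within n (Output S) \<longleftrightarrow> True"
| "queries_within n (Query x y t) \<longleftrightarrow> x < n \<and> y < n \<and> (\<forall>a. queries_within n (t a))"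

primrec depth :: "dtree \<Rightarrow> nat" where
  "depth (Output S) = 0"
| "depth (Query x y t) = Suc (max (depth (t True)) (depth (t False)))"

text \<open>A history lists the past queries with the answers given, oldest first. The adversary may
  depend on the history and on the current query, and may randomize; it does not see the
  internal randomness of the algorithm.\<close>

type_synonym history = "(nat \<times> nat \<times> bool) list"

type_synonym adversary = "history \<Rightarrow> nat \<Rightarrow> nat \<Rightarrow> bool pmf"

definition noisy_answer ::
  "(nat \<Rightarrow> real) \<Rightarrow> adversary \<Rightarrow> history \<Rightarrow> nat \<Rightarrow> nat \<Rightarrow> bool pmf" where
  "noisy_answer v adv h x y =
     bind_pmf (bernoulli_pmf (2/3))
       (\<lambda>correct. if correct then return_pmf (v x \<ge> v y) else adv h x y)"

primrec run_tree ::
  "(nat \<Rightarrow> real) \<Rightarrow> adversary \<Rightarrow> dtree \<Rightarrow> history \<Rightarrow> nat set pmf" where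
  "run_tree v adv (Output S) h = return_pmf S"
| "run_tree v adv (Query x y t) h =
     bind_pmf (noisy_answer v adv h x y) (\<lambda>a. run_tree v adv (t a) (h @ [(x, y, a)]))"

text \<open>A randomized algorithm is a distribution over deterministic decision trees.\<close>

type_synonym algorithm = "dtree pmf"

definition run :: "(nat \<Rightarrow> real) \<Rightarrow> adversary \<Rightarrow> algorithm \<Rightarrow> nat set pmf" where
  "run v adv A = bind_pmf A (\<lambda>t. run_tree v adv t [])"

definition rank_algorithm :: "nat \<Rightarrow> nat \<Rightarrow> real \<Rightarrow> algorithm \<Rightarrow> bool" where
  "rank_algorithm n k p A \<longleftrightarrow>
     (\<forall>t\<in>set_pmf A. queries_within n t) \<and>
     (\<forall>v adv. inj_on v {..<n} \<longrightarrow>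
        measure_pmf.prob (run v adv A) {S. is_top n k v S} \<ge> p)"

text \<open>Worst-case number of queries. On every input, every answer to a query has positive
  probability against some adversary, so every branch of a tree in the support can occur and
  the maximum over inputs, adversaries and coin tosses is the maximal depth of such a tree.\<close>

definition query_complexity :: "algorithm \<Rightarrow> ereal" where
  "query_complexity A = (SUP t\<in>set_pmf A. ereal (real (depth t)))"

end

theory Submission imports Defs "HOL-Combinatorics.Permutations" begin

text \<open>Let the adversary always lie, so that every answer is correct with probability exactly
  \<open>2/3\<close>, and let the values be a uniformly random permutation of \<open>{..<n}\<close>. Put \<open>m = n - k\<close>.
  Raising an element of value \<open>r < m\<close> to a value \<open>j \<ge> m\<close> divides the likelihood of a transcript
  by at most \<open>2\<close> to the number of queries touching that element. By Jensen's inequality, on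
  average over \<open>r\<close> the top set of the old input is still output with probability at least
  \<open>2/3 * 2 powr (- 2 * D / m)\<close>, where \<open>D\<close> bounds the number of queries. Seen from the new input,
  the \<open>k\<close> choices of \<open>j\<close> give \<open>k\<close> different wrong outputs (the element of value \<open>j\<close> is replaced
  by the one of value \<open>m - 1\<close>), so their probabilities add up to at most \<open>1\<close>.
  Hence \<open>k * 2/3 * 2 powr (- 2 * D / m) \<le> 1\<close>.\<close>

section \<open>Top sets of inputs given by permutations\<close>

lemma is_top_unique:
  assumes "is_top n k v S" "is_top n k v T"
  shows "S = T"
proof (rule ccontr)
  assume "S \<noteq> T"
  have fin: "finite S" "finite T" and card: "card S = card T"
    using assms by (auto simp: is_top_def intro: finite_subset[of _ "{..<n}"])
  have "\<not> S \<subseteq> T" "\<not> T \<subseteq> S"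
    using card_subset_eq[of T S] card_subset_eq[of S T] fin card \<open>S \<noteq> T\<close> by auto
  then obtain x y where "x \<in> S" "x \<notin> T" "y \<in> T" "y \<notin> S" by blast
  with assms have "v y < v x" "v x < v y" by (auto simp: is_top_def)
  then show False by simp
qed

lemma is_top_permutes:
  assumes p: "p permutes {..<n}" and k: "k \<le> n"
  shows "is_top n k (\<lambda>x. real (p x)) {x. x < n \<and> n - k \<le> p x}"
proof -
  have "bij_betw p {x. x < n \<and> n - k \<le> p x} {n - k..<n}"
    using p permutes_in_image[OF p] permutes_inj[OF p] permutes_surj[OF p]
    by (intro bij_betw_imageI) (auto simp: inj_on_def image_iff surj_def, metis lessThan_iff)
  then have "card {x. x < n \<and> n - k \<le> p x} = card {n - k..<n}"
    by (rule bij_betw_same_card)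
  with k show ?thesis by (auto simp: is_top_def)
qed

section \<open>Answers and outputs against the lying adversary\<close>

definition liar :: "(nat \<Rightarrow> real) \<Rightarrow> adversary" where
  "liar v h x y = return_pmf (\<not> v x \<ge> v y)"

lemma pmf_noisy_answer_liar:
  "pmf (noisy_answer v (liar v) h x y) a = (if a = (v x \<ge> v y) then 2/3 else 1/3)"
  by (auto simp: noisy_answer_def liar_def pmf_bind indicator_def)

lemma pmf_run_tree_Query:
  "pmf (run_tree v adv (Query x y t) h) S =
    (\<Sum>a\<in>UNIV. pmf (noisy_answer v adv h x y) a * pmf (run_tree v adv (t a) (h @ [(x, y, a)])) S)"
  by (simp add: pmf_bind integral_measure_pmf_real[of UNIV] mult.commute)

text \<open>Jensen's inequality for the convex function 2 powr (- x): each term lies above the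
  tangent at the mean, and the linear parts cancel in the sum.\<close>

lemma sum_powr_neg_ge:
  fixes e :: "'a \<Rightarrow> real"
  assumes "finite R" "R \<noteq> {}"
  shows "real (card R) * 2 powr (- (\<Sum>r\<in>R. e r) / card R) \<le> (\<Sum>r\<in>R. 2 powr (- e r))"
proof -
  define mean where "mean = (\<Sum>r\<in>R. e r) / card R"
  have c: "real (card R) > 0" using assms by (simp add: card_gt_0_iff)
  have tangent: "2 powr (- mean) * (1 + ln 2 * (mean - e r)) \<le> 2 powr (- e r)" for r
  proof -
    have "2 powr (- e r) = 2 powr (- mean) * exp (ln 2 * (mean - e r))"
      by (simp add: powr_def flip: exp_add) (simp add: algebra_simps)
    then show ?thesis
      using exp_ge_add_one_self[of "ln 2 * (mean - e r)"] by simp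
  qed
  have "(\<Sum>r\<in>R. 1 + ln 2 * (mean - e r)) = card R"
    using c by (simp add: sum.distrib sum_subtractf mean_def flip: sum_distrib_left)
  then have "card R * 2 powr (- mean) = (\<Sum>r\<in>R. 2 powr (- mean) * (1 + ln 2 * (mean - e r)))"
    by (simp flip: sum_distrib_left)
  also have "\<dots> \<le> (\<Sum>r\<in>R. 2 powr (- e r))"
    by (intro sum_mono tangent)
  finally show ?thesis by (simp add: mean_def)
qed

text \<open>The exponents \<open>e r\<close> count the queries touching \<open>u r\<close> made so far; they are general to make
  the induction go through.\<close>

lemma run_tree_change_of_measure:
  fixes e :: "'a \<Rightarrow> real"
  assumes R: "finite R" "R \<noteq> {}" and u: "inj_on u R"
    and V: "\<And>r x y. r \<in> R \<Longrightarrow> x \<noteq> u r \<Longrightarrow> y \<noteq> u r \<Longrightarrow> V r x \<ge> V r y \<longleftrightarrow> v x \<ge> v y"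
  shows "card R * 2 powr (- ((\<Sum>r\<in>R. e r) + 2 * real (depth t)) / card R) * pmf (run_tree v (liar v) t h) S
    \<le> (\<Sum>r\<in>R. 2 powr (- e r) * pmf (run_tree (V r) (liar (V r)) t h) S)"
proof (induction t arbitrary: e h)
  case (Output O')
  \<comment> \<open>At a leaf the output no longer depends on the input, so only Jensen's inequality
    for the weights remains.\<close>
  show ?case
    using mult_right_mono[OF sum_powr_neg_ge[OF R, of e], of "indicator {S} O'"]
    by (simp flip: sum_distrib_right)
next
  case (Query x y t)
  define touch :: "'a \<Rightarrow> real" where "touch r = (if x = u r \<or> y = u r then 1 else 0)" for r
  define e' where "e' r = e r + touch r" for r
  define N where "N v = noisy_answer v (liar v) h x y" for v
  define h' where "h' a = h @ [(x, y, a)]" for a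
  define P where "P v a = pmf (run_tree v (liar v) (t a) (h' a)) S" for v a
  define d where "d = depth (Query x y t)"
  have c: "real (card R) > 0" using R by (simp add: card_gt_0_iff)
  \<comment> \<open>A query names at most two elements and \<open>u\<close> is injective, so at most
    two exponents grow; hence the factor 2 before the depth.\<close>
  have "{r\<in>R. x = u r \<or> y = u r} \<subseteq> R" "u ` {r\<in>R. x = u r \<or> y = u r} \<subseteq> {x, y}" by auto
  then have "card {r\<in>R. x = u r \<or> y = u r} \<le> card {x, y}"
    by (intro card_inj_on_le[of u]) (auto intro: inj_on_subset[OF u])
  also have "\<dots> \<le> 2" by (simp add: card_insert_if)
  finally have "(\<Sum>r\<in>R. touch r) \<le> 2"
    using R by (simp add: touch_def sum.If_cases Int_def conj_commute)
  then have sum_e': "(\<Sum>r\<in>R. e' r) \<le> (\<Sum>r\<in>R. e r) + 2"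
    by (simp add: e'_def sum.distrib)
  \<comment> \<open>The depth drops by at least one, which offsets the growth of the exponent sum by
    at most 2.\<close>
  have depth_le: "real (depth (t a)) + 1 \<le> d" for a
    by (cases a) (auto simp: d_def)
  have IH: "card R * 2 powr (- ((\<Sum>r\<in>R. e r) + 2 * real d) / card R) * P v a
      \<le> (\<Sum>r\<in>R. 2 powr (- e' r) * P (V r) a)" for a
  proof -
    have "card R * 2 powr (- ((\<Sum>r\<in>R. e r) + 2 * real d) / card R) * P v a
      \<le> card R * 2 powr (- ((\<Sum>r\<in>R. e' r) + 2 * real (depth (t a))) / card R) * P v a"
      using sum_e' depth_le[of a] c
      by (intro mult_right_mono mult_left_mono powr_mono divide_right_mono) (auto simp: P_def)
    also have "\<dots> \<le> (\<Sum>r\<in>R. 2 powr (- e' r) * P (V r) a)"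
      using Query.IH[of "t a" e' "h' a"] by (simp add: P_def)
    finally show ?thesis .
  qed
  \<comment> \<open>Answers have probability 1/3 or 2/3, so on a touching query the two inputs
    differ by a factor of at most 2, paid for by the larger exponent. Other queries are answered
    alike.\<close>
  have ratio: "pmf (N v) a * 2 powr (- e' r) \<le> 2 powr (- e r) * pmf (N (V r)) a"
    if "r \<in> R" for r a
  proof (cases "x = u r \<or> y = u r")
    case True
    then have "2 powr (- e' r) = 2 powr (- e r) / 2"
      by (simp add: e'_def touch_def powr_diff)
    moreover have "pmf (N v) a / 2 \<le> pmf (N (V r)) a"
      by (simp add: N_def pmf_noisy_answer_liar)
    ultimately show ?thesis
      using mult_left_mono[of "pmf (N v) a / 2" "pmf (N (V r)) a" "2 powr (- e r)"]
      by (simp only: powr_ge_zero times_divide_eq_right times_divide_eq_left mult.commute)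
  next
    case False
    then have "V r x \<ge> V r y \<longleftrightarrow> v x \<ge> v y" using V[OF that, of x y] by auto
    with False show ?thesis
      by (simp add: N_def pmf_noisy_answer_liar e'_def touch_def)
  qed
  have "card R * 2 powr (- ((\<Sum>r\<in>R. e r) + 2 * real d) / card R) * (\<Sum>a\<in>UNIV. pmf (N v) a * P v a)
      = (\<Sum>a\<in>UNIV. pmf (N v) a * (card R * 2 powr (- ((\<Sum>r\<in>R. e r) + 2 * real d) / card R) * P v a))"
    unfolding sum_distrib_left by (intro sum.cong refl) (simp only: mult_ac)
  also have "\<dots> \<le> (\<Sum>a\<in>UNIV. pmf (N v) a * (\<Sum>r\<in>R. 2 powr (- e' r) * P (V r) a))"
    by (intro sum_mono mult_left_mono IH) auto
  also have "\<dots> = (\<Sum>r\<in>R. \<Sum>a\<in>UNIV. pmf (N v) a * 2 powr (- e' r) * P (V r) a)"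
    by (subst sum.swap) (simp only: sum_distrib_left mult.assoc)
  also have "\<dots> \<le> (\<Sum>r\<in>R. \<Sum>a\<in>UNIV. 2 powr (- e r) * pmf (N (V r)) a * P (V r) a)"
    by (intro sum_mono mult_right_mono ratio) (auto simp: P_def)
  also have "\<dots> = (\<Sum>r\<in>R. 2 powr (- e r) * (\<Sum>a\<in>UNIV. pmf (N (V r)) a * P (V r) a))"
    unfolding sum_distrib_left by (intro sum.cong refl) (simp only: mult_ac)
  finally show ?case
    unfolding pmf_run_tree_Query d_def N_def P_def h'_def .
qed

text \<open>Averages the bound for one tree over the random tree; the common depth bound
  \<open>D\<close> makes the factor constant, so it leaves the integral.\<close>

lemma run_change_of_measure:
  fixes D :: real
  assumes R: "finite R" "R \<noteq> {}" and u: "inj_on u R"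
    and V: "\<And>r x y. r \<in> R \<Longrightarrow> x \<noteq> u r \<Longrightarrow> y \<noteq> u r \<Longrightarrow> V r x \<ge> V r y \<longleftrightarrow> v x \<ge> v y"
    and D: "\<And>t. t \<in> set_pmf A \<Longrightarrow> depth t \<le> D"
  shows "card R * 2 powr (- 2 * D / card R) * pmf (run v (liar v) A) S
    \<le> (\<Sum>r\<in>R. pmf (run (V r) (liar (V r)) A) S)"
proof -
  have int: "integrable (measure_pmf A) (\<lambda>t. pmf (run_tree w (liar w) t []) S)" for w
    by (rule measure_pmf.integrable_const_bound[where B = 1]) (auto simp: pmf_le_1)
  have c: "real (card R) > 0" using R by (simp add: card_gt_0_iff)
  have bound: "card R * 2 powr (- 2 * D / card R) * pmf (run_tree v (liar v) t []) S
      \<le> (\<Sum>r\<in>R. pmf (run_tree (V r) (liar (V r)) t []) S)" if "t \<in> set_pmf A" for t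
  proof -
    have "card R * 2 powr (- 2 * D / card R) * pmf (run_tree v (liar v) t []) S
      \<le> card R * 2 powr (- (2 * real (depth t)) / card R) * pmf (run_tree v (liar v) t []) S"
      using c D[OF that]
      by (intro mult_right_mono mult_left_mono powr_mono divide_right_mono) auto
    also have "\<dots> \<le> (\<Sum>r\<in>R. pmf (run_tree (V r) (liar (V r)) t []) S)"
      using run_tree_change_of_measure[where e = "\<lambda>_. 0" and t = t and h = "[]" and S = S, OF R u V]
      by simp
    finally show ?thesis .
  qed
  have "card R * 2 powr (- 2 * D / card R) * pmf (run v (liar v) A) S
    = (\<integral>t. card R * 2 powr (- 2 * D / card R) * pmf (run_tree v (liar v) t []) S \<partial>measure_pmf A)"
    by (simp add: run_def pmf_bind)
  also have "\<dots> \<le> (\<integral>t. (\<Sum>r\<in>R. pmf (run_tree (V r) (liar (V r)) t []) S) \<partial>measure_pmf A)"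
    using int bound by (intro integral_mono_AE) (auto simp: AE_measure_pmf_iff)
  also have "\<dots> = (\<Sum>r\<in>R. pmf (run (V r) (liar (V r)) A) S)"
    using int by (simp add: run_def pmf_bind)
  finally show ?thesis .
qed

section \<open>Raising one value of a permutation\<close>

text \<open>For \<open>r < j\<close> this is a cycle on the values from \<open>r\<close> to
  \<open>j\<close>: shifting down fills the gap at \<open>r\<close>, so permutations stay
  permutations and the other values keep their order.\<close>

definition raise :: "nat \<Rightarrow> nat \<Rightarrow> nat \<Rightarrow> nat" where
  "raise r j i = (if i = r then j else if r < i \<and> i \<le> j then i - 1 else i)"

lemma raise_permutes:
  assumes "r < j" "j < n"
  shows "raise r j permutes {..<n}"
proof (rule bij_imp_permutes)
  have "inj_on (raise r j) {..<n}" "raise r j ` {..<n} \<subseteq> {..<n}"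
    using assms by (auto simp: inj_on_def raise_def split: if_splits)
  then show "bij_betw (raise r j) {..<n} {..<n}"
    by (simp add: bij_betw_def endo_inj_surj)
  show "raise r j x = x" if "x \<notin> {..<n}" for x
    using that assms by (auto simp: raise_def)
qed

lemma raise_le_iff:
  "a \<noteq> r \<Longrightarrow> b \<noteq> r \<Longrightarrow> raise r j a \<le> raise r j b \<longleftrightarrow> a \<le> b"
  by (auto simp: raise_def)

text \<open>The shift lowers the threshold \<open>m\<close> to \<open>m - 1\<close>, and the
  newcomer at \<open>j\<close> is left out. Thus the old top set can be read off the new input and
  \<open>j\<close>, without knowing \<open>r\<close>.\<close>

lemma le_iff_raise:
  assumes "r < m" "m \<le> j"
  shows "m \<le> i \<longleftrightarrow> m - 1 \<le> raise r j i \<and> raise r j i \<noteq> j"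
  using assms by (auto simp: raise_def)

text \<open>Double counting over permutations, \<open>r\<close> and \<open>j\<close>: from the old
  input each \<open>j\<close> contributes at least \<open>C * p\<close> over all \<open>r\<close>;
  from the new input each \<open>r\<close> contributes at most 1 over all \<open>j\<close>.\<close>

lemma rank_algorithm_tradeoff:
  fixes D :: real
  assumes A: "rank_algorithm n k p A" and k: "k < n"
    and D: "\<And>t. t \<in> set_pmf A \<Longrightarrow> depth t \<le> D"
  shows "k * 2 powr (- 2 * D / real (n - k)) * p \<le> 1"
proof -
  define m where "m = n - k"
  define Perm where "Perm = {\<pi>. \<pi> permutes {..<n}}"
  define Q where "Q \<pi> = pmf (run (\<lambda>x. real (\<pi> x)) (liar (\<lambda>x. real (\<pi> x))) A)" for \<pi> :: "nat \<Rightarrow> nat"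
  define Top where "Top \<pi> = {x. x < n \<and> m \<le> \<pi> x}" for \<pi> :: "nat \<Rightarrow> nat"
  define Err where "Err j \<pi> = {x. x < n \<and> m - 1 \<le> \<pi> x \<and> \<pi> x \<noteq> j}" for j and \<pi> :: "nat \<Rightarrow> nat"
  define C where "C = m * 2 powr (- 2 * D / m)"
  have m: "m > 0" "m \<le> n" "card {m..<n} = k" using k by (auto simp: m_def)
  have C: "C \<ge> 0" by (simp add: C_def)
  have fin: "finite Perm" by (simp add: Perm_def finite_permutations)
  have "id \<in> Perm" by (simp add: Perm_def permutes_id)
  with fin have Perm_pos: "card Perm > 0" by (auto simp: card_gt_0_iff)

  \<comment> \<open>The correct output is unique, so the success event is a singleton and its
    probability is a value of the pmf.\<close>
  have success: "p \<le> Q \<pi> (Top \<pi>)" if "\<pi> \<in> Perm" for \<pi>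
  proof -
    let ?v = "\<lambda>x. real (\<pi> x)"
    have \<pi>: "\<pi> permutes {..<n}" using that by (simp add: Perm_def)
    have "is_top n k ?v (Top \<pi>)"
      using is_top_permutes[OF \<pi>, of k] k by (simp add: Top_def m_def)
    then have "{S. is_top n k ?v S} = {Top \<pi>}"
      using is_top_unique by blast
    moreover have "inj_on ?v {..<n}"
      using permutes_inj[OF \<pi>] by (auto simp: inj_on_def)
    ultimately show ?thesis
      using A by (auto simp: rank_algorithm_def Q_def measure_pmf_single dest!: spec[of _ ?v] spec[of _ "liar ?v"])
  qed

  have raised: "C * p \<le> (\<Sum>r<m. Q (raise r j \<circ> \<pi>) (Err j (raise r j \<circ> \<pi>)))"
    if \<pi>: "\<pi> \<in> Perm" and j: "j \<in> {m..<n}" for \<pi> j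
  proof -
    have perm: "\<pi> permutes {..<n}" using \<pi> by (simp add: Perm_def)
    have Err: "Err j (raise r j \<circ> \<pi>) = Top \<pi>" if "r < m" for r
      using le_iff_raise[OF that, of j] j by (auto simp: Err_def Top_def)
    have "C * p \<le> C * Q \<pi> (Top \<pi>)"
      using success[OF \<pi>] C by (intro mult_left_mono)
    also have "\<dots> \<le> (\<Sum>r<m. Q (raise r j \<circ> \<pi>) (Top \<pi>))"
    proof -
      \<comment> \<open>The element moved is \<open>inv \<pi> r\<close>; comparisons between other
        elements are unchanged.\<close>
      have "real (raise r j (\<pi> y)) \<le> real (raise r j (\<pi> x)) \<longleftrightarrow> real (\<pi> y) \<le> real (\<pi> x)"
        if "x \<noteq> inv \<pi> r" "y \<noteq> inv \<pi> r" for r x y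
        using that permutes_inverses(2)[OF perm] raise_le_iff[of "\<pi> y" r "\<pi> x" j]
        by (metis of_nat_le_iff)
      moreover have "inj_on (inv \<pi>) {..<m}"
        using permutes_inj[OF permutes_inv[OF perm]] by (auto simp: inj_on_def)
      ultimately show ?thesis
        using run_change_of_measure[of "{..<m}" "inv \<pi>" "\<lambda>r x. real (raise r j (\<pi> x))"
            "\<lambda>x. real (\<pi> x)" A D "Top \<pi>"] m D
        by (simp add: Q_def C_def lessThan_empty_iff)
    qed
    also have "\<dots> = (\<Sum>r<m. Q (raise r j \<circ> \<pi>) (Err j (raise r j \<circ> \<pi>)))"
      by (simp add: Err)
    finally show ?thesis .
  qed

  have disjoint: "(\<Sum>j\<in>{m..<n}. Q \<pi> (Err j \<pi>)) \<le> 1" if "\<pi> \<in> Perm" for \<pi>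
  proof -
    have perm: "\<pi> permutes {..<n}" using that by (simp add: Perm_def)
    have "inj_on (\<lambda>j. Err j \<pi>) {m..<n}"
    proof (rule inj_onI, rule ccontr)
      \<comment> \<open>The element of value \<open>i\<close> tells the two sets apart: it is
        excluded from \<open>Err i \<pi>\<close> only.\<close>
      fix i j assume ij: "i \<in> {m..<n}" "j \<in> {m..<n}" "Err i \<pi> = Err j \<pi>" "i \<noteq> j"
      then have "inv \<pi> i \<in> Err j \<pi>"
        using permutes_inverses(1)[OF perm] permutes_in_image[OF permutes_inv[OF perm], of i]
        by (auto simp: Err_def)
      with ij(3) have "inv \<pi> i \<in> Err i \<pi>" by simp
      then show False
        using permutes_inverses(1)[OF perm] by (auto simp: Err_def)
    qed
    then have "(\<Sum>j\<in>{m..<n}. Q \<pi> (Err j \<pi>)) = (\<Sum>S\<in>(\<lambda>j. Err j \<pi>) ` {m..<n}. Q \<pi> S)"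
      by (simp add: sum.reindex)
    also have "\<dots> \<le> 1"
      unfolding Q_def by (subst measure_measure_pmf_finite[symmetric]) auto
    finally show ?thesis .
  qed

  have "card Perm * (k * (C * p)) = (\<Sum>j\<in>{m..<n}. \<Sum>\<pi>\<in>Perm. C * p)"
    using m by simp
  also have "\<dots> \<le> (\<Sum>j\<in>{m..<n}. \<Sum>\<pi>\<in>Perm. \<Sum>r<m. Q (raise r j \<circ> \<pi>) (Err j (raise r j \<circ> \<pi>)))"
    by (intro sum_mono raised)
  also have "\<dots> = (\<Sum>j\<in>{m..<n}. \<Sum>r<m. \<Sum>\<pi>\<in>Perm. Q (raise r j \<circ> \<pi>) (Err j (raise r j \<circ> \<pi>)))"
    by (intro sum.cong sum.swap refl)
  \<comment> \<open>For fixed \<open>r\<close> and \<open>j\<close>, composing with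
    \<open>raise r j\<close> permutes \<open>Perm\<close>, so the new input is again
    uniform.\<close>
  also have "\<dots> = (\<Sum>j\<in>{m..<n}. \<Sum>r<m. \<Sum>\<pi>\<in>Perm. Q \<pi> (Err j \<pi>))"
    unfolding Perm_def
    by (intro sum.cong refl setum_permutations_compose_left[symmetric] raise_permutes) auto
  also have "\<dots> = m * (\<Sum>\<pi>\<in>Perm. \<Sum>j\<in>{m..<n}. Q \<pi> (Err j \<pi>))"
    by (subst sum.swap[of _ _ Perm]) (simp add: sum_distrib_left)
  also have "\<dots> \<le> real m * (\<Sum>\<pi>\<in>Perm. 1)"
    by (intro mult_left_mono sum_mono disjoint) auto
  finally have "real (card Perm) * (k * (C * p)) \<le> real (card Perm) * m"
    by (simp add: mult.commute)
  then have "k * (C * p) \<le> m"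
    using Perm_pos by simp
  then have "m * (k * 2 powr (- 2 * D / m) * p) \<le> m * 1"
    by (simp add: C_def mult_ac)
  then show ?thesis
    using m by (simp add: m_def)
qed

theorem mainTheorem15:
  fixes \<epsilon> :: real
  assumes "\<epsilon> > 0"
  shows "\<exists>c>0. \<exists>n\<^sub>0. \<forall>n\<ge>n\<^sub>0. \<forall>k (A :: algorithm).
           1 \<le> k \<longrightarrow> real k \<le> (1 - \<epsilon>) * real n \<longrightarrow> rank_algorithm n k (2/3) A \<longrightarrow>
           ereal (c * (real n * log 2 (real k))) \<le> query_complexity A"
proof (intro exI[of _ "\<epsilon> / 6"] exI[of _ "0 :: nat"] conjI allI impI)
  show "\<epsilon> / 6 > 0" using assms by simp
next
  fix n k :: nat and A :: algorithm
  assume k: "1 \<le> k" "real k \<le> (1 - \<epsilon>) * real n" and A: "rank_algorithm n k (2/3) A"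
  \<comment> \<open>The constant is chosen so that \<open>2 * D / (\<epsilon> * n)\<close> is a
    third of \<open>log 2 k\<close>; the loss in likelihood is then at most the cube root of
    \<open>k\<close>.\<close>
  define D where "D = \<epsilon> / 6 * (real n * log 2 (real k))"
  show "ereal (\<epsilon> / 6 * (real n * log 2 (real k))) \<le> query_complexity A"
  proof (rule ccontr)
    assume "\<not> ?thesis"
    then have "query_complexity A < ereal D" by (simp add: D_def)
    then have D: "depth t < D" if "t \<in> set_pmf A" for t
      using le_less_trans[OF SUP_upper[OF that, of "\<lambda>t. ereal (real (depth t))"]]
      by (metis query_complexity_def less_ereal.simps(1))
    \<comment> \<open>For \<open>k = 1\<close> the logarithm vanishes, but no depth is below
      0.\<close>
    obtain t where "t \<in> set_pmf A" using set_pmf_not_empty by fast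
    from D[OF this] have "D > 0" by simp
    then have "k \<noteq> 1" by (auto simp: D_def)
    with k have k2: "k \<ge> 2" by simp
    have "n > 0" using k by (cases "n = 0") auto
    have gap: "\<epsilon> * n \<le> real n - k" using k by (simp add: algebra_simps)
    moreover have "\<epsilon> * n > 0" using assms \<open>n > 0\<close> by simp
    ultimately have "k < n" by simp
    then have bound: "k * 2 powr (- 2 * D / (real n - k)) * (2/3) \<le> 1"
      using rank_algorithm_tradeoff[OF A, of D] D by (simp add: of_nat_diff less_imp_le)
    \<comment> \<open>With the cube root \<open>w\<close> the tradeoff reads
      \<open>w\<^sup>2 * (2/3) \<le> 1\<close>. Cubing gives \<open>k\<^sup>2\<close> at most 27/8,
      which is below 4 and contradicts \<open>k \<ge> 2\<close>.\<close>
    define w where "w = real k powr (1/3)"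
    have w: "w > 0" using k2 by (simp add: w_def)
    have w3: "w ^ 3 = k" using powr_realpow[OF w, of 3] k2 by (simp add: w_def powr_powr)
    have "2 * D / (real n - k) \<le> 2 * D / (\<epsilon> * n)"
      using gap \<open>\<epsilon> * n > 0\<close> \<open>D > 0\<close> by (intro divide_left_mono) auto
    also have "\<dots> = log 2 k / 3"
      using assms \<open>n > 0\<close> by (simp add: D_def field_simps)
    finally have "2 powr (- (log 2 k / 3)) \<le> 2 powr (- 2 * D / (real n - k))"
      by (intro powr_mono) auto
    moreover have "2 powr (- (log 2 k / 3)) = inverse w"
      using k2 by (simp add: w_def powr_def log_def exp_minus)
    ultimately have "k * inverse w \<le> k * 2 powr (- 2 * D / (real n - k))"
      by (intro mult_left_mono) auto
    with bound have "k * inverse w * (2/3) \<le> 1" by linarith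
    then have "w\<^sup>2 \<le> 3/2"
      using w by (simp add: w3[symmetric] field_simps power2_eq_square power3_eq_cube)
    then have "(w\<^sup>2) ^ 3 \<le> (3/2) ^ 3" by (intro power_mono) auto
    moreover have "(w\<^sup>2) ^ 3 = (real k)\<^sup>2" by (simp flip: w3 power_mult)
    moreover have "(real k)\<^sup>2 \<ge> 2\<^sup>2" using k2 by (intro power_mono) auto
    ultimately show False by (simp add: power3_eq_cube)
  qed
qed

end
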